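(* Let $\alpha>0$ be an irrational number and $M>1$ be an integer. When the values $\|n\alpha\|$, $1\le n\le M$, are arranged in ascending order in the interval $[0,\frac12]$, the gaps (differences) between successive terms take at most $6$ distinct values.
   Context: $\|\cdot\|:\mathbb{R}\to[0,1/2]$ denotes the distance to the nearest integer: $\|x\|=\min(\{|x|\},1-\{|x|\})$, where $\{y\}=y-\lfloor y\rfloor$ is the usual fractional part. *)

theory Defs
  imports Complex_Main
begin

definition dist_nearest_int :: "real \<Rightarrow> real"
  where "dist_nearest_int x = min (frac \<bar>x\<bar>) (1 - frac \<bar>x\<bar>)"

text \<open>
  The values are kept as a list, so coinciding values would contribute a gap \<open>0\<close>;
  for irrational \<open>\<alpha>\<close> they are pairwise distinct.
\<close>
definition ordered_values :: "real \<Rightarrow> nat \<Rightarrow> real list"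
  where "ordered_values \<alpha> M = sort (map (\<lambda>n. dist_nearest_int (real n * \<alpha>)) [1..<Suc M])"

text \<open>Only gaps between two terms of the list count, not those to the ends of \<open>[0, 1/2]\<close>.\<close>
definition successive_gaps :: "real list \<Rightarrow> real set"
  where "successive_gaps xs = {xs ! Suc i - xs ! i | i. Suc i < length xs}"

end

theory Submission
  imports Defs
begin

text \<open>
  The values \<open>\<parallel>n\<alpha>\<parallel>\<close> with \<open>1 \<le> n \<le> M\<close> are points of the orbit segment \<open>i\<alpha> mod 1\<close>, \<open>-M \<le> i \<le> M\<close>, of
  the rotation by \<open>\<alpha>\<close>: this segment is symmetric about \<open>0\<close>, and \<open>\<parallel>n\<alpha>\<parallel>\<close> is whichever of \<open>n\<alpha>\<close> and
  \<open>-n\<alpha>\<close> falls into \<open>[0, 1/2]\<close> modulo \<open>1\<close>. Conversely, every point of the segment that lies strictly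
  between two of the values is itself one of them (\<open>strictly_between_orbit_point_is_value\<close>). Hence
  two different successive values bound a gap of the orbit segment.

  The three gap theorem (\<open>three_gap\<close>) applies to any orbit segment \<open>a \<le> i \<le> b\<close>. Its proof rotates a
  gap by \<open>\<alpha>\<close> for as long as the result is still a gap. As the indices of the end points increase, this
  stops, and it can only stop at one of three gaps: the two that have the last point \<open>b\<alpha>\<close> as an end
  point, and the one that contains \<open>(a - 1)\<alpha>\<close>, whose image is broken up by the first point \<open>a\<alpha>\<close>. Since
  rotation preserves lengths, there are at most three lengths. Coinciding values can only add the
  gap \<open>0\<close>, so four is a bound for every real \<open>\<alpha>\<close>.
\<close>

section \<open>The three gap theorem\<close>

definition is_gap :: "real set \<Rightarrow> real \<Rightarrow> real \<Rightarrow> bool"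
  where "is_gap A x y \<longleftrightarrow> x \<in> A \<and> y \<in> A \<and> x < y \<and> (\<forall>z\<in>A. \<not> (x < z \<and> z < y))"

text \<open>
  The orbit segment on the circle, unrolled to a \<open>1\<close>-periodic subset of the line, so that the
  linear order can be used to speak of gaps.
\<close>
definition orbit_segment :: "real \<Rightarrow> int \<Rightarrow> int \<Rightarrow> real set"
  where "orbit_segment \<alpha> a b = {of_int i * \<alpha> + of_int m | i m. a \<le> i \<and> i \<le> b}"

lemma orbit_segmentI:
  assumes "x = of_int i * \<alpha> + of_int m" "a \<le> i" "i \<le> b"
  shows "x \<in> orbit_segment \<alpha> a b"
  using assms by (auto simp: orbit_segment_def)

lemma orbit_segmentE:
  assumes "x \<in> orbit_segment \<alpha> a b"
  obtains i m where "x = of_int i * \<alpha> + of_int m" "a \<le> i" "i \<le> b"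
  using assms by (auto simp: orbit_segment_def)

lemma orbit_segment_add_int:
  assumes "x \<in> orbit_segment \<alpha> a b"
  shows "x + of_int k \<in> orbit_segment \<alpha> a b"
proof -
  obtain i m where "x = of_int i * \<alpha> + of_int m" "a \<le> i" "i \<le> b"
    using assms by (rule orbit_segmentE)
  then show ?thesis
    by (intro orbit_segmentI[of _ i _ "m + k"]) auto
qed

lemma is_gap_add_int:
  assumes "is_gap (orbit_segment \<alpha> a b) x y"
  shows "is_gap (orbit_segment \<alpha> a b) (x + of_int k) (y + of_int k)"
proof -
  have "\<not> (x + of_int k < z \<and> z < y + of_int k)" if "z \<in> orbit_segment \<alpha> a b" for z
    using assms orbit_segment_add_int[OF that, of "- k"] by (auto simp: is_gap_def)
  then show ?thesis
    using assms by (auto simp: is_gap_def intro: orbit_segment_add_int)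
qed

lemma is_gap_right_unique: "is_gap A x y \<Longrightarrow> is_gap A x y' \<Longrightarrow> y = y'"
  unfolding is_gap_def by (meson linorder_neqE)

lemma is_gap_left_unique: "is_gap A x y \<Longrightarrow> is_gap A x' y \<Longrightarrow> x = x'"
  unfolding is_gap_def by (meson linorder_neqE)

lemma is_gap_around_unique:
  assumes "is_gap A x y" "x < p" "p < y" "is_gap A x' y'" "x' < p" "p < y'"
  shows "x = x' \<and> y = y'"
  using assms unfolding is_gap_def by (meson linorder_neqE order.strict_trans)

text \<open>
  The gaps, normalised by an integer translation, at which repeated rotation by \<open>\<alpha>\<close> may stop. Each
  of the three alternatives admits at most one gap.
\<close>
definition is_last_gap :: "real \<Rightarrow> int \<Rightarrow> int \<Rightarrow> real \<Rightarrow> real \<Rightarrow> bool"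
  where "is_last_gap \<alpha> a b x y \<longleftrightarrow> is_gap (orbit_segment \<alpha> a b) x y \<and>
    (x = of_int b * \<alpha> \<or> y = of_int b * \<alpha> \<or>
     (x < of_int (a - 1) * \<alpha> \<and> of_int (a - 1) * \<alpha> < y))"

text \<open>
  A point that appears inside the rotated gap is not the image of a point of the segment, so it is
  an integer translate of the first point \<open>a\<alpha>\<close>.
\<close>
lemma is_gap_rotate:
  assumes gap: "is_gap (orbit_segment \<alpha> a b) x y"
    and x: "x = of_int i * \<alpha> + of_int m" "a \<le> i" "i < b"
    and y: "y = of_int j * \<alpha> + of_int l" "a \<le> j" "j < b"
  shows "is_gap (orbit_segment \<alpha> a b) (x + \<alpha>) (y + \<alpha>) \<or>
    (\<exists>x' y'. is_last_gap \<alpha> a b x' y' \<and> y' - x' = y - x)"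
proof (cases "\<exists>z\<in>orbit_segment \<alpha> a b. x + \<alpha> < z \<and> z < y + \<alpha>")
  case True
  then obtain k n where z: "x + \<alpha> < of_int k * \<alpha> + of_int n" "of_int k * \<alpha> + of_int n < y + \<alpha>"
    and k: "a \<le> k" "k \<le> b"
    by (auto elim!: orbit_segmentE)
  have "k = a"
  proof (rule ccontr)
    assume "k \<noteq> a"
    then have "of_int (k - 1) * \<alpha> + of_int n \<in> orbit_segment \<alpha> a b"
      using k by (intro orbit_segmentI[of _ "k - 1" _ n]) auto
    moreover have "x < of_int (k - 1) * \<alpha> + of_int n" "of_int (k - 1) * \<alpha> + of_int n < y"
      using z by (auto simp: algebra_simps)
    ultimately show False
      using gap by (auto simp: is_gap_def)
  qed
  with z have "x + of_int (- n) < of_int (a - 1) * \<alpha>" "of_int (a - 1) * \<alpha> < y + of_int (- n)"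
    by (auto simp: algebra_simps)
  with is_gap_add_int[OF gap, of "- n"]
  have "is_last_gap \<alpha> a b (x + of_int (- n)) (y + of_int (- n))"
    by (simp add: is_last_gap_def)
  moreover have "(y + of_int (- n)) - (x + of_int (- n)) = y - x"
    by simp
  ultimately show ?thesis
    by blast
next
  case False
  have "x + \<alpha> \<in> orbit_segment \<alpha> a b"
    using x by (intro orbit_segmentI[of _ "i + 1" _ m]) (auto simp: algebra_simps)
  moreover have "y + \<alpha> \<in> orbit_segment \<alpha> a b"
    using y by (intro orbit_segmentI[of _ "j + 1" _ l]) (auto simp: algebra_simps)
  ultimately show ?thesis
    using False gap by (auto simp: is_gap_def)
qed

lemma gap_length_of_last_gap:
  assumes "is_gap (orbit_segment \<alpha> a b) x y"
  shows "\<exists>x' y'. is_last_gap \<alpha> a b x' y' \<and> y' - x' = y - x"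
proof -
  obtain i m where "x = of_int i * \<alpha> + of_int m" "a \<le> i" "i \<le> b"
    using assms by (auto simp: is_gap_def elim: orbit_segmentE)
  moreover obtain j l where "y = of_int j * \<alpha> + of_int l" "a \<le> j" "j \<le> b"
    using assms by (auto simp: is_gap_def elim: orbit_segmentE)
  ultimately show ?thesis
    using assms
  proof (induction "nat (b - i)" arbitrary: i j x y rule: less_induct)
    case less
    consider "i = b" | "j = b" | "i < b" "j < b"
      using less.prems by linarith
    then show ?case
    proof cases
      case 1
      then have "is_last_gap \<alpha> a b (x + of_int (- m)) (y + of_int (- m))"
        using is_gap_add_int[OF less.prems(7), of "- m"] less.prems(1)
        by (simp add: is_last_gap_def)
      moreover have "(y + of_int (- m)) - (x + of_int (- m)) = y - x"
        by simp
      ultimately show ?thesis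
        by blast
    next
      case 2
      then have "is_last_gap \<alpha> a b (x + of_int (- l)) (y + of_int (- l))"
        using is_gap_add_int[OF less.prems(7), of "- l"] less.prems(4)
        by (simp add: is_last_gap_def)
      moreover have "(y + of_int (- l)) - (x + of_int (- l)) = y - x"
        by simp
      ultimately show ?thesis
        by blast
    next
      case 3
      from is_gap_rotate[OF less.prems(7,1,2) 3(1) less.prems(4,5) 3(2)] show ?thesis
      proof
        assume "is_gap (orbit_segment \<alpha> a b) (x + \<alpha>) (y + \<alpha>)"
        moreover have "x + \<alpha> = of_int (i + 1) * \<alpha> + of_int m" "y + \<alpha> = of_int (j + 1) * \<alpha> + of_int l"
          using less.prems(1,4) by (auto simp: algebra_simps)
        ultimately have "\<exists>x' y'. is_last_gap \<alpha> a b x' y' \<and> y' - x' = (y + \<alpha>) - (x + \<alpha>)"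
          using 3 less.prems by (intro less.hyps[of "i + 1" "x + \<alpha>" "y + \<alpha>" "j + 1"]) auto
        then show ?thesis
          by simp
      qed
    qed
  qed
qed

text \<open>
  The conclusion exhibits three lengths instead of bounding a cardinality, because \<open>card\<close> would be
  \<open>0\<close> on an infinite set of lengths.
\<close>
theorem three_gap:
  "\<exists>d1 d2 d3. \<forall>x y. is_gap (orbit_segment \<alpha> a b) x y \<longrightarrow> y - x \<in> {d1, d2, d3}"
proof -
  let ?G = "is_gap (orbit_segment \<alpha> a b)"
  let ?p = "of_int b * \<alpha>" and ?q = "of_int (a - 1) * \<alpha>"
  obtain d1 where d1: "\<And>y. ?G ?p y \<Longrightarrow> y - ?p = d1"
    using is_gap_right_unique by metis
  obtain d2 where d2: "\<And>x. ?G x ?p \<Longrightarrow> ?p - x = d2"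
    using is_gap_left_unique by metis
  obtain d3 where d3: "\<And>x y. ?G x y \<Longrightarrow> x < ?q \<Longrightarrow> ?q < y \<Longrightarrow> y - x = d3"
    using is_gap_around_unique by metis
  have "y - x \<in> {d1, d2, d3}" if "is_last_gap \<alpha> a b x y" for x y
    using that d1 d2 d3 unfolding is_last_gap_def by blast
  then have "\<forall>x y. ?G x y \<longrightarrow> y - x \<in> {d1, d2, d3}"
    by (metis gap_length_of_last_gap)
  then show ?thesis
    by blast
qed

section \<open>Distances to the nearest integer as orbit points\<close>

lemma dist_nearest_int_bounds: "0 \<le> dist_nearest_int x" "dist_nearest_int x \<le> 1 / 2"
  using frac_lt_1[of "\<bar>x\<bar>"] by (auto simp: dist_nearest_int_def min_def)

lemma dist_nearest_int_cases:
  obtains m where "dist_nearest_int x = x + of_int m"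
  | m where "dist_nearest_int x = - x + of_int m"
proof -
  have "\<exists>m. dist_nearest_int x = x + of_int m \<or> dist_nearest_int x = - x + of_int m"
  proof (cases "x \<ge> 0"; cases "frac \<bar>x\<bar> \<le> 1 - frac \<bar>x\<bar>")
    assume "x \<ge> 0" "frac \<bar>x\<bar> \<le> 1 - frac \<bar>x\<bar>"
    then show ?thesis
      by (intro exI[of _ "- \<lfloor>x\<rfloor>"]) (auto simp: dist_nearest_int_def frac_def)
  next
    assume "x \<ge> 0" "\<not> frac \<bar>x\<bar> \<le> 1 - frac \<bar>x\<bar>"
    then show ?thesis
      by (intro exI[of _ "1 + \<lfloor>x\<rfloor>"]) (auto simp: dist_nearest_int_def frac_def)
  next
    assume "\<not> x \<ge> 0" "frac \<bar>x\<bar> \<le> 1 - frac \<bar>x\<bar>"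
    then show ?thesis
      by (intro exI[of _ "- \<lfloor>- x\<rfloor>"]) (auto simp: dist_nearest_int_def frac_def)
  next
    assume "\<not> x \<ge> 0" "\<not> frac \<bar>x\<bar> \<le> 1 - frac \<bar>x\<bar>"
    then show ?thesis
      by (intro exI[of _ "1 + \<lfloor>- x\<rfloor>"]) (auto simp: dist_nearest_int_def frac_def)
  qed
  then show ?thesis
    using that by blast
qed

text \<open>
  A number in \<open>[0, 1/2]\<close> is determined modulo \<open>1\<close> and up to sign: two of them differ by at most
  \<open>1/2\<close>, and if their sum is an integer, then both are \<open>0\<close> or both are \<open>1/2\<close>.
\<close>
lemma dist_nearest_int_eqI:
  assumes z: "z = x + of_int m \<or> z = - x + of_int m" and "0 \<le> z" "z \<le> 1 / 2"
  shows "dist_nearest_int x = z"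
proof -
  let ?d = "dist_nearest_int x"
  obtain n where "?d = x + of_int n \<or> ?d = - x + of_int n"
    by (metis dist_nearest_int_cases)
  with z have "?d - z = of_int (n - m) \<or> ?d + z = of_int (n + m)"
    by auto
  then obtain k where k: "?d - z = of_int k \<or> ?d + z = of_int k"
    by metis
  note bounds = dist_nearest_int_bounds[of x] assms(2,3)
  from k show ?thesis
  proof
    assume k: "?d - z = of_int k"
    then have "-1 < real_of_int k" "real_of_int k < 1"
      using bounds by linarith+
    then have "k = 0"
      by linarith
    with k show ?thesis
      by simp
  next
    assume k: "?d + z = of_int k"
    then have "-1 < real_of_int k" "real_of_int k < 2"
      using bounds by linarith+
    then have "k = 0 \<or> k = 1"
      by linarith
    with k bounds show ?thesis
      by auto
  qed
qed

lemma set_ordered_values: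
  "set (ordered_values \<alpha> M) = (\<lambda>n. dist_nearest_int (real n * \<alpha>)) ` {1..M}"
  by (auto simp: ordered_values_def)

lemma ordered_values_subset_orbit_segment:
  "set (ordered_values \<alpha> M) \<subseteq> orbit_segment \<alpha> (- int M) (int M)"
proof
  fix x assume "x \<in> set (ordered_values \<alpha> M)"
  then obtain n where n: "n \<le> M" and x: "x = dist_nearest_int (real n * \<alpha>)"
    by (auto simp: set_ordered_values)
  show "x \<in> orbit_segment \<alpha> (- int M) (int M)"
  proof (cases rule: dist_nearest_int_cases[of "real n * \<alpha>"])
    case (1 m)
    with n x show ?thesis
      by (intro orbit_segmentI[of _ "int n" _ m]) auto
  next
    case (2 m)
    with n x show ?thesis
      by (intro orbit_segmentI[of _ "- int n" _ m]) auto
  qed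
qed

text \<open>The index \<open>i = 0\<close> drops out because no integer lies strictly between \<open>0\<close> and \<open>1/2\<close>.\<close>
lemma strictly_between_orbit_point_is_value:
  assumes "z \<in> orbit_segment \<alpha> (- int M) (int M)" and "0 < z" "z < 1 / 2"
  shows "z \<in> set (ordered_values \<alpha> M)"
proof -
  obtain i m where z: "z = of_int i * \<alpha> + of_int m" and i: "- int M \<le> i" "i \<le> int M"
    using assms(1) by (rule orbit_segmentE)
  have "i \<noteq> 0"
  proof
    assume "i = 0"
    with z assms(2,3) have "0 < real_of_int m" "real_of_int m < 1"
      by auto
    then show False
      by simp
  qed
  with i have "nat \<bar>i\<bar> \<in> {1..M}"
    by auto
  moreover have "z = real (nat \<bar>i\<bar>) * \<alpha> + of_int m \<or> z = - (real (nat \<bar>i\<bar>) * \<alpha>) + of_int m"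
    using z by (cases "i \<ge> 0") auto
  then have "dist_nearest_int (real (nat \<bar>i\<bar>) * \<alpha>) = z"
    using assms(2,3) by (intro dist_nearest_int_eqI) auto
  ultimately show ?thesis
    unfolding set_ordered_values by (metis image_eqI)
qed

section \<open>Gaps between successive values\<close>

lemma sorted_nothing_between:
  assumes "sorted xs" "Suc i < length xs" "z \<in> set xs"
  shows "\<not> (xs ! i < z \<and> z < xs ! Suc i)"
proof -
  obtain k where k: "k < length xs" "z = xs ! k"
    using assms(3) by (auto simp: in_set_conv_nth)
  show ?thesis
  proof (cases "k \<le> i")
    case True
    then show ?thesis
      using sorted_nth_mono[OF assms(1), of k i] assms(2) k by auto
  next
    case False
    then show ?thesis
      using sorted_nth_mono[OF assms(1), of "Suc i" k] k by auto
  qed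
qed

lemma successive_values_is_gap:
  fixes \<alpha> :: real and M :: nat
  defines "xs \<equiv> ordered_values \<alpha> M"
  assumes i: "Suc i < length xs" and neq: "xs ! i \<noteq> xs ! Suc i"
  shows "is_gap (orbit_segment \<alpha> (- int M) (int M)) (xs ! i) (xs ! Suc i)"
proof -
  have sorted: "sorted xs"
    by (simp add: xs_def ordered_values_def)
  have mem: "xs ! i \<in> set xs" "xs ! Suc i \<in> set xs"
    using i by auto
  have "0 \<le> x \<and> x \<le> 1 / 2" if "x \<in> set xs" for x
    using that dist_nearest_int_bounds unfolding xs_def set_ordered_values by blast
  with mem have lower: "0 \<le> xs ! i" and upper: "xs ! Suc i \<le> 1 / 2"
    by blast+
  have "xs ! i < xs ! Suc i"
    using sorted_nth_mono[OF sorted, of i "Suc i"] i neq by simp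
  moreover have "\<not> (xs ! i < z \<and> z < xs ! Suc i)"
    if "z \<in> orbit_segment \<alpha> (- int M) (int M)" for z
  proof
    assume z: "xs ! i < z \<and> z < xs ! Suc i"
    then have "0 < z" "z < 1 / 2"
      using lower upper by linarith+
    with that have "z \<in> set xs"
      unfolding xs_def by (rule strictly_between_orbit_point_is_value)
    with z show False
      using sorted_nothing_between[OF sorted i] by blast
  qed
  ultimately show ?thesis
    using mem ordered_values_subset_orbit_segment[of \<alpha> M] by (auto simp: is_gap_def xs_def)
qed

theorem card_successive_gaps_le_4: "card (successive_gaps (ordered_values \<alpha> M)) \<le> 4"
proof -
  obtain d1 d2 d3 where d:
    "\<And>x y. is_gap (orbit_segment \<alpha> (- int M) (int M)) x y \<Longrightarrow> y - x \<in> {d1, d2, d3}"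
    using three_gap[of \<alpha> "- int M" "int M"] by blast
  have "successive_gaps (ordered_values \<alpha> M) \<subseteq> set [0, d1, d2, d3]"
  proof
    fix g assume "g \<in> successive_gaps (ordered_values \<alpha> M)"
    then obtain i where i: "Suc i < length (ordered_values \<alpha> M)"
      and g: "g = ordered_values \<alpha> M ! Suc i - ordered_values \<alpha> M ! i"
      by (auto simp: successive_gaps_def)
    show "g \<in> set [0, d1, d2, d3]"
    proof (cases "ordered_values \<alpha> M ! i = ordered_values \<alpha> M ! Suc i")
      case True
      with g show ?thesis
        by simp
    next
      case False
      from d[OF successive_values_is_gap[OF i False]] g show ?thesis
        by simp
    qed
  qed
  then have "card (successive_gaps (ordered_values \<alpha> M)) \<le> card (set [0, d1, d2, d3])"
    by (intro card_mono) auto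
  also have "\<dots> \<le> length [0, d1, d2, d3]"
    by (rule card_length)
  finally show ?thesis
    by simp
qed

theorem corollary1p2:
  fixes \<alpha> :: real and M :: nat
  assumes "\<alpha> > 0" and "\<alpha> \<notin> \<rat>" and "M > 1"
  shows "card (successive_gaps (ordered_values \<alpha> M)) \<le> 6"
  using card_successive_gaps_le_4[of \<alpha> M] by linarith

end
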